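(* Let $Q \subseteq \mathbb{R}^n_+$ be a covering set. Then, for any $k \in \mathbb{N}$, the $k$-aggregation closure $\mathcal{A}_k(Q)$ is a polyhedron.
   Context: $\mathbb{R}_+$ and $\mathbb{R}_-$ denote the nonnegative and nonpositive reals; $\mathbb{N}^n$ denotes the set of nonnegative integer vectors; $[k]=\{1,\ldots,k\}$. A covering set is a set of the form $\{x\in\mathbb{R}^n_+ \mid M_i x \le d_i \ \forall i\in I\}$ where each $(M_i,d_i)\in\mathbb{R}^n_-\times\mathbb{R}_-$ (with $M_i$ viewed as a row vector) and $I$ is an arbitrary, possibly infinite, index set. For a convex set $S\subseteq\mathbb{R}^n_+$, let $\Lambda(S):=\{f\in\mathbb{R}^n \mid \sup\{f^{\mathsf T}x \mid x\in S\}<\infty\}$. The $k$-aggregation closure of $S$ is $$\mathcal{A}_k(S):=\bigcap_{f^1,\ldots,f^k\in\Lambda(S)}\operatorname{conv}\big(\{x\in\mathbb{N}^n \mid (f^j)^{\mathsf T}x\le\sup\{(f^j)^{\mathsf T}s \mid s\in S\}\ \ \forall j\in[k]\}\big).$$ A polyhedron is an intersection of finitely many closed half-spaces. *)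

theory Defs
  imports "HOL-Analysis.Analysis"
begin

text \<open>The possibly infinite system of inequalities is given by the set \<open>C\<close> of its pairs
  \<open>(M\<^sub>i, d\<^sub>i)\<close>, that is, by the range of the indexed family.\<close>

definition covering_set :: "(real ^ 'n) set \<Rightarrow> bool" where
  "covering_set Q \<longleftrightarrow>
     (\<exists>C :: ((real ^ 'n) \<times> real) set.
        (\<forall>(M, d) \<in> C. (\<forall>i. M $ i \<le> 0) \<and> d \<le> 0) \<and>
        Q = {x. (\<forall>i. 0 \<le> x $ i) \<and> (\<forall>(M, d) \<in> C. M \<bullet> x \<le> d)})"

definition nat_vectors :: "(real ^ 'n) set" where
  "nat_vectors = {x. \<forall>i. x $ i \<in> \<nat>}"

text \<open>Suprema are taken in the extended reals, so the supremum over the empty set is \<open>-\<infinity>\<close>.\<close>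

definition support_value :: "(real ^ 'n) set \<Rightarrow> real ^ 'n \<Rightarrow> ereal" where
  "support_value S f = (SUP x\<in>S. ereal (f \<bullet> x))"

definition Lambda :: "(real ^ 'n) set \<Rightarrow> (real ^ 'n) set" where
  "Lambda S = {f. support_value S f < \<infinity>}"

text \<open>A \<open>k\<close>-tuple of vectors is a function on \<open>nat\<close> of which only the values on \<open>{1..k}\<close> matter.\<close>

definition aggregation_closure :: "nat \<Rightarrow> (real ^ 'n) set \<Rightarrow> (real ^ 'n) set" where
  "aggregation_closure k S =
     (\<Inter>f \<in> {1..k} \<rightarrow> Lambda S.
        convex hull {x \<in> nat_vectors. \<forall>j\<in>{1..k}. ereal (f j \<bullet> x) \<le> support_value S (f j)})"

end

theory Submission
  imports Defs
begin

text \<open>All vectors in \<open>Lambda Q\<close> are nonpositive when \<open>Q\<close> is nonempty, so the closure is an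
  intersection of convex hulls of upward closed subsets of the natural points. Such an intersection
  is a polyhedron for every family \<open>\<X>\<close> of upward closed sets. By Dickson's lemma each upward
  closed set is finitely generated, so its convex hull is a polytope plus the nonnegative orthant.
  Pass to the closure \<open>C\<close> of \<open>\<X>\<close> in the compact space of subsets with the product topology.
  The intersection of the hulls does not change, because a point outside the hull of an
  upward closed set \<open>Y\<close> is outside the hull of every \<open>X\<close> that agrees with \<open>Y\<close> on a suitable
  finite set. Each \<open>Y\<close> in \<open>C\<close> is the least element of the open set of those members of \<open>C\<close> that
  contain the generators of \<open>Y\<close>, so by compactness finitely many \<open>Y\<close> suffice.\<close>

section \<open>Sums of polytopes and finitely generated cones\<close>

lemma polyhedron_slice:
  fixes K :: "('a::euclidean_space \<times> real) set"
  assumes "polyhedron K"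
  shows "polyhedron {x. (x, t) \<in> K}"
proof -
  from assms obtain F where F: "finite F" "K = \<Inter>F"
      and *: "\<And>h. h \<in> F \<Longrightarrow> \<exists>a b. h = {x. a \<bullet> x \<le> b}"
    unfolding polyhedron_def by metis
  have "polyhedron {x. (x, t) \<in> h}" if h: "h \<in> F" for h
  proof -
    from *[OF h] obtain a b where "h = {x. a \<bullet> x \<le> b}"
      by blast
    then have "{x. (x, t) \<in> h} = {x. fst a \<bullet> x \<le> b - snd a * t}"
      by (auto simp: inner_prod_def)
    then show ?thesis
      by (simp add: polyhedron_halfspace_le)
  qed
  then have "polyhedron (\<Inter>((\<lambda>h. {x. (x, t) \<in> h}) ` F))"
    using F(1) by (intro polyhedron_Inter) auto
  moreover have "{x. (x, t) \<in> K} = \<Inter>((\<lambda>h. {x. (x, t) \<in> h}) ` F)"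
    using F(2) by auto
  ultimately show ?thesis by simp
qed

text \<open>Homogenization: the sum is the slice at height 1 of the finitely generated cone
  over \<open>(G \<times> {1}) \<union> (B \<times> {0})\<close>.\<close>

lemma polyhedron_convex_hull_plus_convex_cone_hull:
  fixes G B :: "'a::euclidean_space set"
  assumes "finite G" "finite B"
  shows "polyhedron (convex hull G + convex_cone hull B)"
proof -
  define K where "K = convex_cone hull (G \<times> {1::real} \<union> B \<times> {0})"
  have "convex_cone hull (G \<times> {1::real}) = insert 0 (conic hull ((convex hull G) \<times> {1}))"
    by (simp add: convex_cone_hull_separate convex_hull_Times)
  moreover have "convex_cone hull (B \<times> {0::real}) = (convex_cone hull B) \<times> {0}"
  proof -
    have lin: "linear (\<lambda>x::'a. (x, 0::real))"
      by (simp add: linear_iff)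
    have img: "S \<times> {0} = (\<lambda>x. (x, 0::real)) ` S" for S :: "'a set"
      by auto
    show ?thesis
      unfolding img by (rule convex_cone_hull_linear_image[OF lin])
  qed
  ultimately have K: "K = (\<Union>x \<in> insert 0 (conic hull ((convex hull G) \<times> {1})).
      \<Union>y \<in> (convex_cone hull B) \<times> {0}. {x + y})"
    unfolding K_def convex_cone_hull_Un by simp
  have "convex hull G + convex_cone hull B = {x. (x, 1) \<in> K}"
  proof (intro equalityI subsetI CollectI)
    fix x assume "x \<in> convex hull G + convex_cone hull B"
    then obtain g b where gb: "x = g + b" "g \<in> convex hull G" "b \<in> convex_cone hull B"
      by (rule set_plus_elim)
    have "(g, 1) \<in> conic hull ((convex hull G) \<times> {1::real})"
      using gb(2) by (intro hull_inc) simp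
    moreover have "(x, 1) = (g, 1) + (b, 0::real)"
      using gb(1) by simp
    ultimately show "(x, 1) \<in> K"
      unfolding K using gb(3) by blast
  next
    fix x assume "x \<in> {x. (x, 1) \<in> K}"
    then have "(x, 1) \<in> K" by (rule CollectD)
    then obtain u v where u: "u \<in> insert 0 (conic hull ((convex hull G) \<times> {1::real}))"
        and v: "v \<in> (convex_cone hull B) \<times> {0}" and x: "(x, 1) = u + v"
      unfolding K by blast
    from v obtain b where b: "b \<in> convex_cone hull B" "v = (b, 0)"
      by (elim SigmaE singletonE) (rule that, simp_all)
    \<comment> \<open>Since \<open>v\<close> has height 0, \<open>u\<close> has height 1. This
      excludes the extra point 0 of the cone and later forces the scaling factor \<open>c\<close> to
      be 1.\<close>
    have "snd u = 1" and xu: "x = fst u + b"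
      using arg_cong[OF x, of snd] arg_cong[OF x, of fst] by (simp_all add: b(2))
    then have "u \<in> conic hull ((convex hull G) \<times> {1})"
      using u by (metis insertE snd_zero zero_neq_one)
    then obtain c z where z: "u = c *\<^sub>R z" "z \<in> (convex hull G) \<times> {1}"
      unfolding conic_hull_explicit by (elim CollectE exE conjE)
    then have "c = 1"
      using \<open>snd u = 1\<close> by (simp add: mem_Times_iff)
    then have "fst u \<in> convex hull G"
      using z by (simp add: mem_Times_iff)
    then show "x \<in> convex hull G + convex_cone hull B"
      unfolding xu using b(1) by (rule set_plus_intro)
  qed
  moreover have "polyhedron {x. (x, 1) \<in> K}"
    unfolding K_def using assms by (intro polyhedron_slice polyhedron_convex_cone_hull) auto
  ultimately show ?thesis
    by (rule ssubst)
qed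

section \<open>Natural points: their convex hull, Dickson's lemma, finiteness\<close>

lemma nonneg_orthant_eq_convex_cone_hull:
  "{x::real^'n. 0 \<le> x} = convex_cone hull (range (\<lambda>i. axis i 1))" (is "?P = ?C")
proof
  show "?P \<subseteq> ?C"
  proof
    fix x :: "real^'n" assume x: "x \<in> ?P"
    have "(\<Sum>i\<in>I. x $ i *\<^sub>R axis i 1) \<in> ?C" if "finite I" for I
      using that
    proof induction
      case empty
      then show ?case by (simp add: convex_cone_hull_contains_0)
    next
      case (insert i I)
      moreover have "x $ i *\<^sub>R axis i 1 \<in> ?C"
        using x by (intro convex_cone_hull_mul hull_inc) (auto simp: less_eq_vec_def)
      ultimately show ?case
        by (simp add: convex_cone_hull_add)
    qed
    from this[of UNIV] show "x \<in> ?C"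
      using basis_expansion[of x] by (simp add: scalar_mult_eq_scaleR)
  qed
  show "?C \<subseteq> ?P"
    by (rule hull_minimal)
       (auto simp: less_eq_vec_def axis_def convex_cone_iff)
qed

lemma nat_vectors_nonneg: "x \<in> nat_vectors \<Longrightarrow> 0 \<le> x"
  by (auto simp: nat_vectors_def less_eq_vec_def) (metis Nats_cases of_nat_0_le_iff)

text \<open>Every nonnegative point lies in a cube with side length a natural number
  \<open>m\<close> and one corner at the origin; the vertices of that cube are natural
  points.\<close>

lemma convex_hull_nat_vectors:
  "convex hull nat_vectors = {x::real^'n. 0 \<le> x}"
proof
  have "nat_vectors \<subseteq> {x::real^'n. 0 \<le> x}"
    using nat_vectors_nonneg by blast
  moreover have "convex {x::real^'n. 0 \<le> x}"
    using nonneg_orthant_eq_convex_cone_hull convex_convex_cone_hull by metis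
  ultimately show "convex hull nat_vectors \<subseteq> {x::real^'n. 0 \<le> x}"
    by (rule hull_minimal)
  show "{x::real^'n. 0 \<le> x} \<subseteq> convex hull nat_vectors"
  proof
    fix x :: "real^'n" assume "x \<in> {x. 0 \<le> x}"
    then have x: "0 \<le> x $ i" for i by (simp add: less_eq_vec_def)
    obtain m :: nat where m: "(\<Sum>i\<in>UNIV. x $ i) < real m"
      using reals_Archimedean2 by blast
    then have m0: "real m > 0"
      using x by (smt (verit) sum_nonneg)
    have le: "x $ i \<le> real m" for i
      using member_le_sum[of i UNIV "\<lambda>i. x $ i"] x m by force
    have "x /\<^sub>R real m \<in> cbox 0 One"
      unfolding mem_box
    proof
      fix b :: "real^'n" assume b: "b \<in> Basis"
      then obtain i where "b = axis i 1" by (auto simp: Basis_vec_def)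
      then have "(x /\<^sub>R real m) \<bullet> b = x $ i / real m"
        by (simp add: inner_axis divide_inverse)
      then show "0 \<bullet> b \<le> (x /\<^sub>R real m) \<bullet> b \<and> (x /\<^sub>R real m) \<bullet> b \<le> One \<bullet> b"
        using x[of i] le[of i] m0 b by simp
    qed
    then have "x \<in> (\<lambda>x. real m *\<^sub>R x) ` cbox 0 One"
      using m0 by (intro image_eqI[where x = "x /\<^sub>R real m"]) auto
    also have "\<dots> = convex hull ((\<lambda>x. real m *\<^sub>R x) ` {x. \<forall>i\<in>Basis. x \<bullet> i = 0 \<or> x \<bullet> i = 1})"
      by (simp add: unit_interval_convex_hull convex_hull_scaling)
    also have "\<dots> \<subseteq> convex hull nat_vectors"
    proof (intro hull_mono subsetI)
      fix y assume "y \<in> (\<lambda>x. real m *\<^sub>R x) ` {x::real^'n. \<forall>i\<in>Basis. x \<bullet> i = 0 \<or> x \<bullet> i = 1}"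
      then obtain z where z: "y = real m *\<^sub>R z" "\<And>i. z $ i = 0 \<or> z $ i = 1"
        by (auto simp: Basis_vec_def inner_axis)
      show "y \<in> nat_vectors"
        unfolding nat_vectors_def
      proof (intro CollectI allI)
        fix i show "y $ i \<in> \<nat>"
          using z(2)[of i] by (auto simp: z(1))
      qed
    qed
    finally show "x \<in> convex hull nat_vectors" .
  qed
qed

text \<open>The core of Dickson's lemma: an injective sequence is thinned out once for each
  coordinate, and coordinates that are already monotone stay so under further thinning.\<close>

lemma infinite_nat_vectors_monotone_sequence:
  fixes X :: "(real^'n) set"
  assumes "infinite X" "X \<subseteq> nat_vectors"
  obtains s :: "nat \<Rightarrow> real^'n" where "inj s" "range s \<subseteq> X" "mono s"
proof -
  obtain s0 :: "nat \<Rightarrow> real^'n" where s0: "inj s0" "range s0 \<subseteq> X"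
    using assms(1) infinite_countable_subset by blast
  have "\<exists>r::nat \<Rightarrow> nat. strict_mono r \<and> (\<forall>i\<in>I. mono (\<lambda>n. s0 (r n) $ i))" if "finite I" for I
    using that
  proof induction
    case empty
    show ?case by (auto intro: strict_mono_id[unfolded id_def])
  next
    case (insert i I)
    then obtain r :: "nat \<Rightarrow> nat" where r: "strict_mono r" "\<And>j. j \<in> I \<Longrightarrow> mono (\<lambda>n. s0 (r n) $ j)"
      by blast
    define t where "t n = nat \<lfloor>s0 (r n) $ i\<rfloor>" for n
    have t: "s0 (r n) $ i = real (t n)" for n
    proof -
      have "s0 (r n) $ i \<in> \<nat>"
        using s0(2) assms(2) by (auto simp: nat_vectors_def)
      then show ?thesis
        by (auto simp: t_def elim!: Nats_cases)
    qed
    obtain q :: "nat \<Rightarrow> nat" where q: "strict_mono q" "mono (\<lambda>n. t (q n))"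
    proof -
      obtain q where q: "strict_mono q" "monoseq (\<lambda>n. t (q n))"
        using seq_monosub by blast
      show ?thesis
      proof (cases "incseq (\<lambda>n. t (q n))")
        case True
        then show ?thesis using q that by blast
      next
        case False
        then have dec: "decseq (\<lambda>n. t (q n))"
          using q(2) by (simp add: monoseq_iff)
        \<comment> \<open>A decreasing sequence of naturals is constant from the index
          \<open>N\<close> of a minimal value on, so dropping the first \<open>N\<close> terms of
          \<open>q\<close> leaves a constant, hence monotone, sequence.\<close>
        define N where "N = (ARG_MIN (\<lambda>n. t (q n)) n. True)"
        have N: "t (q N) \<le> t (q n)" for n
          unfolding N_def by (rule arg_min_nat_le) simp
        have "t (q (N + n)) = t (q N)" for n
          using N[of "N + n"] decseqD[OF dec, of N "N + n"] by simp
        moreover have "strict_mono (\<lambda>n. q (N + n))"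
          using q(1) by (simp add: strict_mono_def)
        ultimately show ?thesis
          using that[of "\<lambda>n. q (N + n)"] by (simp add: mono_def)
      qed
    qed
    have "strict_mono (\<lambda>n. r (q n))"
      using r(1) q(1) by (simp add: strict_mono_def)
    moreover have "mono (\<lambda>n. s0 (r (q n)) $ j)" if "j \<in> insert i I" for j
    proof (cases "j = i")
      case True
      then show ?thesis using q(2) by (simp add: t mono_def)
    next
      case False
      then have "mono (\<lambda>n. s0 (r n) $ j)" using that r(2) by blast
      then show ?thesis
        using strict_mono_mono[OF q(1)] by (simp add: mono_def)
    qed
    ultimately show ?case by blast
  qed
  from this[of UNIV] obtain r :: "nat \<Rightarrow> nat"
    where r: "strict_mono r" "\<And>i. mono (\<lambda>n. s0 (r n) $ i)" by auto
  show thesis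
  proof (rule that[of "s0 \<circ> r"])
    show "inj (s0 \<circ> r)"
      using s0(1) strict_mono_imp_inj_on[OF r(1)] by (simp add: inj_compose)
    show "range (s0 \<circ> r) \<subseteq> X" using s0(2) by auto
    show "mono (s0 \<circ> r)" using r(2) by (auto simp: mono_def less_eq_vec_def)
  qed
qed

text \<open>At a natural point all terms of the inner product are nonnegative, so each single term
  is below \<open>d\<close>; this leaves finitely many values per coordinate.\<close>

lemma finite_nat_vectors_bounded:
  fixes c :: "real^'n"
  assumes c: "\<And>i. c $ i > 0"
  shows "finite {x \<in> nat_vectors. c \<bullet> x < d}"
proof -
  have bound: "x $ i \<le> d / c $ i" if x: "x \<in> nat_vectors" "c \<bullet> x < d" for x i
  proof -
    have nn: "x $ j \<ge> 0" for j
      using nat_vectors_nonneg[OF x(1)] by (simp add: less_eq_vec_def)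
    have "c $ i * x $ i \<le> c \<bullet> x"
      unfolding inner_vec_def inner_real_def
      using member_le_sum[of i UNIV "\<lambda>i. c $ i * x $ i"] nn c by (simp add: less_imp_le)
    then show ?thesis
      using nn[of i] c[of i] x(2) by (simp add: field_simps)
  qed
  have "{x \<in> nat_vectors. c \<bullet> x < d} \<subseteq>
      {x. \<forall>i. x $ i \<in> (of_nat ` {..nat \<lfloor>d / c $ i\<rfloor>})}" (is "_ \<subseteq> ?R")
  proof (intro subsetI CollectI allI)
    fix x i assume *: "x \<in> {x \<in> nat_vectors. c \<bullet> x < d}"
    then obtain m where m: "x $ i = of_nat m"
      by (auto simp: nat_vectors_def) (metis Nats_cases)
    have "real m \<le> d / c $ i"
      using * m bound[of x i] by simp
    then have "m \<le> nat \<lfloor>d / c $ i\<rfloor>" by (simp add: le_nat_iff le_floor_iff)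
    then show "x $ i \<in> of_nat ` {..nat \<lfloor>d / c $ i\<rfloor>}" using m by blast
  qed
  moreover have "?R \<subseteq> vec_lambda ` (\<Pi>\<^sub>E i\<in>UNIV. of_nat ` {..nat \<lfloor>d / c $ i\<rfloor>})"
    by (auto intro!: image_eqI[where x = "vec_nth _"])
  moreover have "finite (vec_lambda ` (\<Pi>\<^sub>E i\<in>UNIV. (of_nat ` {..nat \<lfloor>d / c $ i\<rfloor>} :: real set)))"
    by (intro finite_imageI finite_PiE) auto
  ultimately show ?thesis
    by (meson finite_subset)
qed


section \<open>Upward closed sets of natural points and their convex hulls\<close>

definition nat_upset :: "(real^'n) set \<Rightarrow> bool" where
  "nat_upset X \<longleftrightarrow> X \<subseteq> nat_vectors \<and> (\<forall>x\<in>X. \<forall>y\<in>nat_vectors. x \<le> y \<longrightarrow> y \<in> X)"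

lemma nat_vectors_add: "x \<in> nat_vectors \<Longrightarrow> y \<in> nat_vectors \<Longrightarrow> x + y \<in> nat_vectors"
  by (simp add: nat_vectors_def)

lemma nat_vectors_diff:
  assumes "x \<in> nat_vectors" "y \<in> nat_vectors" "y \<le> x"
  shows "x - y \<in> nat_vectors"
  unfolding nat_vectors_def
proof (intro CollectI allI)
  fix i
  obtain a b where "x $ i = of_nat a" "y $ i = of_nat b"
    using assms(1,2) by (auto simp: nat_vectors_def) (metis Nats_cases)
  moreover from this have "b \<le> a"
    using assms(3) by (auto simp: less_eq_vec_def dest: spec[of _ i])
  ultimately have "(x - y) $ i = of_nat (a - b)"
    by (simp add: of_nat_diff)
  then show "(x - y) $ i \<in> \<nat>" by simp
qed

text \<open>The minimal elements serve as generators. Infinitely many of them would include a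
  monotone injective sequence, whose first two terms are distinct and comparable.\<close>

lemma nat_upset_finitely_generated:
  assumes X: "nat_upset X"
  obtains G where "finite G" "X = G + nat_vectors"
proof -
  define G where "G = {x \<in> X. \<forall>y\<in>X. y \<le> x \<longrightarrow> y = x}"
  have XN: "X \<subseteq> nat_vectors" and up: "\<And>x y. x \<in> X \<Longrightarrow> y \<in> nat_vectors \<Longrightarrow> x \<le> y \<Longrightarrow> y \<in> X"
    using X by (auto simp: nat_upset_def)
  have "finite G"
  proof (rule ccontr)
    assume "infinite G"
    moreover have "G \<subseteq> nat_vectors" using XN by (auto simp: G_def)
    ultimately obtain s :: "nat \<Rightarrow> _" where s: "inj s" "range s \<subseteq> G" "mono s"
      by (rule infinite_nat_vectors_monotone_sequence)
    have "s 0 \<le> s 1" using s(3) by (simp add: mono_def)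
    moreover have "s 0 \<in> G" "s 1 \<in> G" using s(2) by auto
    ultimately have "s 0 = s 1" by (simp add: G_def)
    then show False using s(1) by (auto dest: injD)
  qed
  moreover have "X = G + nat_vectors"
  proof
    show "X \<subseteq> G + nat_vectors"
    proof
      fix x assume x: "x \<in> X"
      \<comment> \<open>Lying below \<open>x\<close> bounds the coordinate sum, and
        \<open>+ 1\<close> makes the bound strict. By finiteness there is a minimal element of
        \<open>X\<close> below \<open>x\<close>.\<close>
      have "{y \<in> X. y \<le> x} \<subseteq> {y \<in> nat_vectors. 1 \<bullet> y < 1 \<bullet> x + 1}"
      proof
        fix y assume y: "y \<in> {y \<in> X. y \<le> x}"
        then have "1 \<bullet> y \<le> 1 \<bullet> x"
          by (auto simp: inner_vec_def less_eq_vec_def intro: sum_mono)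
        then show "y \<in> {y \<in> nat_vectors. 1 \<bullet> y < 1 \<bullet> x + 1}" using y XN by auto
      qed
      then have fin: "finite {y \<in> X. y \<le> x}"
        by (rule finite_subset) (rule finite_nat_vectors_bounded, simp)
      have "x \<in> {y \<in> X. y \<le> x}" using x by simp
      from finite_has_minimal2[OF fin this] obtain g where g: "g \<in> {y \<in> X. y \<le> x}"
          and min: "\<And>y. y \<in> {y \<in> X. y \<le> x} \<Longrightarrow> y \<le> g \<Longrightarrow> g = y"
        by blast
      have "y = g" if "y \<in> X" "y \<le> g" for y
      proof -
        have "y \<le> x" using \<open>y \<le> g\<close> g by (blast intro: order_trans)
        with that show ?thesis using min by blast
      qed
      then have "g \<in> G" using g unfolding G_def by blast
      moreover have "x - g \<in> nat_vectors"
        using g x XN by (intro nat_vectors_diff) auto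
      ultimately show "x \<in> G + nat_vectors"
        using set_plus_intro[of g G "x - g" nat_vectors] by simp
    qed
    show "G + nat_vectors \<subseteq> X"
    proof
      fix z assume "z \<in> G + nat_vectors"
      then obtain g w where "z = g + w" "g \<in> X" "w \<in> nat_vectors"
        by (auto simp: set_plus_def G_def)
      then show "z \<in> X"
        using up[of g z] XN nat_vectors_add nat_vectors_nonneg[of w] by auto
    qed
  qed
  ultimately show thesis by (rule that)
qed

text \<open>Convex hulls commute with Minkowski sums, which splits off the orthant from the polytope
  spanned by the generators.\<close>

lemma polyhedron_convex_hull_nat_upset:
  assumes "nat_upset X"
  shows "polyhedron (convex hull X)"
proof -
  obtain G where G: "finite G" "X = G + nat_vectors"
    using nat_upset_finitely_generated[OF assms] .
  then have "convex hull X = convex hull G + convex_cone hull (range (\<lambda>i. axis i 1))"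
    by (simp add: convex_hull_set_plus convex_hull_nat_vectors nonneg_orthant_eq_convex_cone_hull)
  then show ?thesis
    using polyhedron_convex_hull_plus_convex_cone_hull[OF G(1), of "range (\<lambda>i. axis i 1)"] by simp
qed

text \<open>The hull is a polyhedron, hence closed, so a hyperplane separates \<open>p\<close> from
  it. The normal is nonnegative because \<open>Y\<close> recedes in every coordinate direction, and
  the strict gap at \<open>p\<close> leaves room to tilt it.\<close>

lemma nat_upset_separate_point:
  fixes p :: "real^'n"
  assumes Y: "nat_upset Y" and p: "p \<notin> convex hull Y"
  obtains c d where "\<And>i. c $ i > 0" "c \<bullet> p < d" "\<And>y. y \<in> Y \<Longrightarrow> d \<le> c \<bullet> y"
proof (cases "Y = {}")
  case True
  \<comment> \<open>With \<open>Y\<close> empty the last condition is vacuous: the all-ones normal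
    and any bound above its value at \<open>p\<close> will do.\<close>
  then show thesis using that[of 1 "1 \<bullet> p + 1"] by simp
next
  case False
  then obtain y0 where y0: "y0 \<in> Y" by blast
  obtain a b where ab: "a \<bullet> p < b" "\<And>x. x \<in> convex hull Y \<Longrightarrow> b < a \<bullet> x"
    using separating_hyperplane_closed_point[OF convex_convex_hull
        polyhedron_imp_closed[OF polyhedron_convex_hull_nat_upset[OF Y]] p] by blast
  have a: "0 \<le> a $ i" for i
  proof (rule ccontr)
    assume neg: "\<not> 0 \<le> a $ i"
    \<comment> \<open>From \<open>y0\<close>, \<open>m\<close> unit steps along coordinate
      \<open>i\<close> lower the value of \<open>a\<close> to below \<open>b\<close>.\<close>
    obtain m :: nat where m: "(a \<bullet> y0 - b) / (- a $ i) < real m"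
      using reals_Archimedean2 by blast
    have N: "real m *\<^sub>R axis i 1 \<in> nat_vectors"
      by (auto simp: nat_vectors_def axis_def)
    have "y0 + real m *\<^sub>R axis i 1 \<in> Y"
      using Y y0 nat_vectors_add[OF _ N, of y0] nat_vectors_nonneg[OF N]
      by (auto simp: nat_upset_def)
    then have "b < a \<bullet> (y0 + real m *\<^sub>R axis i 1)"
      by (intro ab(2) hull_inc)
    also have "\<dots> = a \<bullet> y0 + real m * a $ i"
      by (simp add: inner_add_right inner_axis)
    finally show False
      using m neg by (simp add: field_simps)
  qed
  \<comment> \<open>A small tilt of the nonnegative normal \<open>a\<close> makes it strictly positive.\<close>
  define e where "e = (b - a \<bullet> p) / (1 + \<bar>1 \<bullet> p\<bar>)"
  have e: "e > 0" using ab(1) by (simp add: e_def add_pos_nonneg)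
  \<comment> \<open>The denominator of \<open>e\<close> is chosen so that the tilt uses up less than
    the gap \<open>b - a \<bullet> p\<close>.\<close>
  have "e * (1 \<bullet> p) < e * (1 + \<bar>1 \<bullet> p\<bar>)"
    using e by (intro mult_strict_left_mono) auto
  also have "\<dots> = b - a \<bullet> p"
    by (simp add: e_def add_pos_nonneg less_imp_neq)
  finally have "(a + e *\<^sub>R 1) \<bullet> p < b"
    by (simp add: inner_add_left)
  moreover have "b \<le> (a + e *\<^sub>R 1) \<bullet> y" if y: "y \<in> Y" for y
  proof -
    have "0 \<le> 1 \<bullet> y"
      using Y y nat_vectors_nonneg[of y] unfolding inner_vec_def
      by (intro sum_nonneg) (auto simp: nat_upset_def less_eq_vec_def)
    then show ?thesis
      using ab(2)[OF hull_inc[OF y]] e by (simp add: inner_add_left)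
        (smt (verit) mult_nonneg_nonneg)
  qed
  moreover have "(a + e *\<^sub>R 1) $ i > 0" for i
    using a[of i] e by simp
  ultimately show thesis by (intro that)
qed

text \<open>Since the separating normal \<open>c\<close> is strictly positive, only finitely many natural points
  lie on the side of \<open>p\<close>; these form \<open>B\<close>.\<close>

lemma convex_hull_nat_upset_finite_determination:
  fixes p :: "real^'n"
  assumes Y: "nat_upset Y" and p: "p \<notin> convex hull Y"
  obtains B where "finite B"
    "\<And>X. X \<subseteq> nat_vectors \<Longrightarrow> X \<inter> B \<subseteq> Y \<Longrightarrow> p \<notin> convex hull X"
proof -
  obtain c d where c: "\<And>i. c $ i > 0" "c \<bullet> p < d" "\<And>y. y \<in> Y \<Longrightarrow> d \<le> c \<bullet> y"
    using nat_upset_separate_point[OF Y p] by metis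
  show thesis
  proof (rule that)
    show "finite {x \<in> nat_vectors. c \<bullet> x < d}"
      using c(1) by (rule finite_nat_vectors_bounded)
    fix X :: "(real^'n) set"
    assume "X \<subseteq> nat_vectors" "X \<inter> {x \<in> nat_vectors. c \<bullet> x < d} \<subseteq> Y"
    then have "X \<subseteq> {x. d \<le> c \<bullet> x}"
      using c(3) by (auto simp: not_le[symmetric])
    then have "convex hull X \<subseteq> {x. d \<le> c \<bullet> x}"
      by (rule hull_minimal) (rule convex_halfspace_ge)
    then show "p \<notin> convex hull X"
      using c(2) by auto
  qed
qed

section \<open>Compactness in the space of subsets and reduction to a finite family\<close>

lemma compact_UNIV_bool_fun: "compact (UNIV :: ('a \<Rightarrow> bool) set)"
proof -
  have "compact_space (product_topology (\<lambda>_::'a. euclidean :: bool topology) UNIV)"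
    unfolding compact_space_product_topology
    by (auto simp: compact_space_def intro: finite_imp_compact)
  then show ?thesis
    by (simp add: euclidean_product_topology compact_space_def)
qed

theorem polyhedron_INT_convex_hull_nat_upset:
  fixes \<X> :: "(real^'n) set set"
  assumes up: "\<And>X. X \<in> \<X> \<Longrightarrow> nat_upset X"
  shows "polyhedron (\<Inter>X\<in>\<X>. convex hull X)"
proof -
  \<comment> \<open>Subsets are encoded as predicates, since the function type carries the product
    topology.\<close>
  define C where "C = closure ((\<lambda>X x. x \<in> X) ` \<X>)"
  have "compact C"
    using compact_Int_closed[OF compact_UNIV_bool_fun closed_closure] by (simp add: C_def)
  \<comment> \<open>The predicates that agree with \<open>P\<close> on a finite set form an open
    neighbourhood of \<open>P\<close>, so one of them comes from the family.\<close>
  have approx: "\<exists>X\<in>\<X>. \<forall>x\<in>B. x \<in> X \<longleftrightarrow> P x" if "P \<in> C" "finite B" for P B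
  proof -
    have "open {f. \<forall>x\<in>B. f x \<in> {P x}}"
      using product_topology_basis'[OF that(2), of "\<lambda>x. {P x}" "\<lambda>x. x"] by (simp add: open_discrete)
    moreover have "P \<in> {f. \<forall>x\<in>B. f x \<in> {P x}} \<inter> closure ((\<lambda>X x. x \<in> X) ` \<X>)"
      using that(1) by (simp add: C_def)
    ultimately have "{f. \<forall>x\<in>B. f x \<in> {P x}} \<inter> (\<lambda>X x. x \<in> X) ` \<X> \<noteq> {}"
      using open_Int_closure_eq_empty by blast
    then show ?thesis by auto
  qed
  \<comment> \<open>Each instance of the defining conditions involves at most two points, so it
    passes to limits.\<close>
  have upC: "nat_upset (Collect P)" if P: "P \<in> C" for P
    unfolding nat_upset_def
  proof (intro conjI ballI impI subsetI)
    fix x assume "x \<in> Collect P"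
    then show "x \<in> nat_vectors"
      using approx[OF P, of "{x}"] up by (auto simp: nat_upset_def)
  next
    fix x y assume "x \<in> Collect P" "y \<in> nat_vectors" "x \<le> y"
    then show "y \<in> Collect P"
      using approx[OF P, of "{x, y}"] up by (auto simp: nat_upset_def)
  qed
  then have "\<forall>P\<in>C. \<exists>G. finite G \<and> Collect P = G + nat_vectors"
    using nat_upset_finitely_generated by metis
  then obtain G where G: "\<And>P. P \<in> C \<Longrightarrow> finite (G P)"
      "\<And>P. P \<in> C \<Longrightarrow> Collect P = G P + nat_vectors"
    by metis
  \<comment> \<open>Only the finitely many generators of \<open>P\<close> are tested, so
    \<open>U P\<close> is open; yet every upward closed set in it contains all of
    \<open>Collect P\<close>.\<close>
  define U where "U P = {f. \<forall>g\<in>G P. f g \<in> {True}}" for P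
  have "open (U P)" if "P \<in> C" for P
    unfolding U_def using product_topology_basis'[OF G(1)[OF that], of "\<lambda>_. {True}" "\<lambda>x. x"]
    by (simp add: open_discrete)
  moreover have "C \<subseteq> (\<Union>P\<in>C. U P)"
  proof
    fix P assume P: "P \<in> C"
    have "0 \<in> nat_vectors" by (simp add: nat_vectors_def)
    then have "G P \<subseteq> Collect P"
      unfolding G(2)[OF P] using set_zero_plus2[of nat_vectors "G P"] by (simp add: add.commute)
    then show "P \<in> (\<Union>P\<in>C. U P)" using P by (auto simp: U_def)
  qed
  ultimately obtain D where D: "D \<subseteq> C" "finite D" "C \<subseteq> (\<Union>P\<in>D. U P)"
    using compactE_image[OF \<open>compact C\<close>] by metis
  have "(\<Inter>X\<in>\<X>. convex hull X) = (\<Inter>P\<in>D. convex hull (Collect P))"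
  proof (intro equalityI subsetI INT_I)
    \<comment> \<open>A set from \<open>D\<close> may be a mere limit of the family. A member that
      agrees with it on the determining set \<open>B\<close> would exclude \<open>p\<close> as
      well.\<close>
    fix p P assume p: "p \<in> (\<Inter>X\<in>\<X>. convex hull X)" and "P \<in> D"
    then have P: "P \<in> C" using D(1) by blast
    show "p \<in> convex hull (Collect P)"
    proof (rule ccontr)
      assume "p \<notin> convex hull (Collect P)"
      then obtain B where B: "finite B"
          "\<And>X. X \<subseteq> nat_vectors \<Longrightarrow> X \<inter> B \<subseteq> Collect P \<Longrightarrow> p \<notin> convex hull X"
        using convex_hull_nat_upset_finite_determination[OF upC[OF P]] by metis
      obtain X where "X \<in> \<X>" "\<forall>x\<in>B. x \<in> X \<longleftrightarrow> P x"
        using approx[OF P B(1)] by blast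
      then have "p \<notin> convex hull X"
        using up by (intro B(2)) (auto simp: nat_upset_def)
      then show False using p \<open>X \<in> \<X>\<close> by blast
    qed
  next
    \<comment> \<open>Conversely, the cover puts some set of \<open>D\<close> inside each member of
      the family.\<close>
    fix p X assume p: "p \<in> (\<Inter>P\<in>D. convex hull (Collect P))" and X: "X \<in> \<X>"
    have "(\<lambda>x. x \<in> X) \<in> C"
      unfolding C_def using X closure_subset by fast
    then obtain P where P: "P \<in> D" "(\<lambda>x. x \<in> X) \<in> U P"
      using D(3) by blast
    have "Collect P \<subseteq> X"
    proof
      fix x assume "x \<in> Collect P"
      then obtain g w where gw: "x = g + w" "g \<in> G P" "w \<in> nat_vectors"
        using G(2)[of P] D(1) P(1) by (auto simp: set_plus_def)
      then have "g \<in> X" using P(2) by (simp add: U_def)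
      then show "x \<in> X"
        using gw up[OF X] nat_vectors_add[of g w] nat_vectors_nonneg[of w]
        by (auto simp: nat_upset_def)
    qed
    then show "p \<in> convex hull X"
      using p P(1) hull_mono by blast
  qed
  moreover have "polyhedron (\<Inter>P\<in>D. convex hull (Collect P))"
    using D(1,2) upC by (intro polyhedron_Inter) (auto intro: polyhedron_convex_hull_nat_upset)
  ultimately show ?thesis by simp
qed

section \<open>Covering sets and their aggregation closures\<close>

lemma Lambda_covering_set_nonpos:
  fixes f :: "real^'n"
  assumes Q: "covering_set Q" "Q \<noteq> {}" and f: "f \<in> Lambda Q"
  shows "f \<le> 0"
  unfolding less_eq_vec_def
proof (intro allI, rule ccontr)
  fix i assume neg: "\<not> f $ i \<le> 0 $ i"
  obtain C where C: "\<And>M d j. (M, d) \<in> C \<Longrightarrow> M $ j \<le> 0"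
      "Q = {x. (\<forall>i. 0 \<le> x $ i) \<and> (\<forall>(M, d) \<in> C. M \<bullet> x \<le> d)}"
    using Q(1) unfolding covering_set_def by blast
  obtain q where q: "q \<in> Q" using Q(2) by blast
  obtain r where r: "support_value Q f \<le> ereal r"
    using f by (cases "support_value Q f") (auto simp: Lambda_def)
  \<comment> \<open>Nonpositive rows let a coordinate grow without leaving \<open>Q\<close>. The
    length \<open>t\<close> raises the value of \<open>f\<close> at \<open>q\<close> by enough to
    exceed the bound \<open>r\<close>.\<close>
  define t where "t = (\<bar>r\<bar> + \<bar>f \<bullet> q\<bar> + 1) / f $ i"
  have t: "t \<ge> 0" using neg by (simp add: t_def)
  have "M \<bullet> (q + t *\<^sub>R axis i 1) \<le> d" if Md: "(M, d) \<in> C" for M d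
  proof -
    have "M \<bullet> q \<le> d" using q Md C(2) by auto
    moreover have "t * M $ i \<le> 0" using t C(1)[OF Md] by (simp add: mult_nonneg_nonpos)
    ultimately show ?thesis by (simp add: inner_add_right inner_axis)
  qed
  moreover have "0 \<le> (q + t *\<^sub>R axis i 1) $ j" for j
    using q t C(2) by (auto simp: axis_def)
  ultimately have "q + t *\<^sub>R axis i 1 \<in> Q"
    unfolding C(2) by auto
  then have "ereal (f \<bullet> (q + t *\<^sub>R axis i 1)) \<le> support_value Q f"
    unfolding support_value_def by (rule SUP_upper)
  then have "f \<bullet> (q + t *\<^sub>R axis i 1) \<le> r"
    using r by (metis ereal_less_eq(3) order_trans)
  moreover have "f \<bullet> (q + t *\<^sub>R axis i 1) = f \<bullet> q + (\<bar>r\<bar> + \<bar>f \<bullet> q\<bar> + 1)"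
    using neg by (simp add: inner_add_right inner_axis t_def)
  ultimately show False by linarith
qed

theorem theorem2:
  fixes Q :: "(real ^ 'n) set" and k :: nat
  assumes "covering_set Q"
  shows "polyhedron (aggregation_closure k Q)"
proof -
  let ?X = "\<lambda>f. {x \<in> nat_vectors. \<forall>j\<in>{1..k}. ereal (f j \<bullet> x) \<le> support_value Q (f j)}"
  have "nat_upset (?X f)" if f: "f \<in> {1..k} \<rightarrow> Lambda Q" for f
  proof -
    have "ereal (f j \<bullet> y) \<le> support_value Q (f j)"
      if xy: "x \<le> y" "ereal (f j \<bullet> x) \<le> support_value Q (f j)" and j: "j \<in> {1..k}" for x y j
    proof (cases "Q = {}")
      case True
      \<comment> \<open>For empty \<open>Q\<close> every vector lies in \<open>Lambda Q\<close>,
        whatever its signs, but the support value is minus infinity and no \<open>x\<close>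
        satisfies the constraint.\<close>
      then show ?thesis using xy(2) by (simp add: support_value_def bot_ereal_def)
    next
      case False
      then have "f j \<le> 0"
        using Lambda_covering_set_nonpos[OF assms] f j by blast
      then have "f j \<bullet> y \<le> f j \<bullet> x"
        using xy(1) unfolding inner_vec_def
        by (auto simp: less_eq_vec_def intro!: sum_mono mult_left_mono_neg)
      then show ?thesis using xy(2) by (meson ereal_less_eq(3) order_trans)
    qed
    then show ?thesis by (auto simp: nat_upset_def)
  qed
  then have "polyhedron (\<Inter>X\<in>?X ` ({1..k} \<rightarrow> Lambda Q). convex hull X)"
    by (intro polyhedron_INT_convex_hull_nat_upset) auto
  then show ?thesis
    by (simp add: aggregation_closure_def)
qed

end
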